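(* Let $X$ be a connected finite polyhedron, let $g:X\to D_k(X)$ be a submap of an $n$-valued map $f:X\to D_n(X)$, and let $\bar f=(\bar f_1,\dots,\bar f_n)$ be the basic lifting of $f$. Then $g$ has a lifting of the form $\bar g=(\bar f_{i_1},\dots,\bar f_{i_k})$ for some indices $i_j\in\{1,\dots,n\}$ (that is, $\bar g:\tilde X\to F_k(\tilde X,\pi)$ satisfies $p^k\circ\bar g=g\circ p$). Furthermore, if $g$ is irreducible, then $\{\bar f_{i_1},\dots,\bar f_{i_k}\}$ is a $\sigma$-class of $\bar f$.
   Context: For a space $Y$, $F_n(Y)=\{(y_1,\dots,y_n)\in Y^n\mid y_i\ne y_j \text{ for } i\neq j\}$ with the subspace topology, and $D_n(Y)=F_n(Y)/\Sigma_n$ (unordered $n$-element subsets) with the quotient topology. An $n$-valued map is a continuous function $f:X\to D_n(Y)$. A submap of $f$ is a $k$-valued map $g:X\to D_k(Y)$ ($1\le k\le n$) with $g(x)\subseteq f(x)$ for all $x$; it is proper if $k<n$. A map with no proper submap is irreducible. Let $p:\tilde X\to X$ be the universal covering, with $\pi_1(X)$ acting on $\tilde X$ by covering transformations. The orbit configuration space is $F_n(\tilde X,\pi)=\{(\tilde x_1,\dots,\tilde x_n)\in\tilde X^n\mid p(\tilde x_i)\neq p(\tilde x_j)\text{ for } i\neq j\}$; applying $p$ to each coordinate gives a covering map $p^n:F_n(\tilde X,\pi)\to D_n(X)$. Fixing basepoints of $\tilde X$ and $F_n(\tilde X,\pi)$ (the latter lying over the image under $f\circ p$ of the former), the basic lifting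 of $f$ is the unique basepoint-preserving continuous map $\bar f=(\bar f_1,\dots,\bar f_n):\tilde X\to F_n(\tilde X,\pi)$ with $p^n\circ\bar f=f\circ p$. There are uniquely determined functions $\phi_i:\pi_1(X)\to\pi_1(X)$ ($1\le i\le n$) and a homomorphism $\sigma:\pi_1(X)\to\Sigma_n$, $\alpha\mapsto\sigma_\alpha$, such that $\bar f_i(\alpha\tilde x)=\phi_i(\alpha)\bar f_{\sigma_\alpha^{-1}(i)}(\tilde x)$ for all $\alpha\in\pi_1(X)$, $\tilde x\in\tilde X$ and all $i$. For $i,j\in\{1,\dots,n\}$ write $i\sim j$ if $\sigma_\gamma(j)=i$ for some $\gamma\in\pi_1(X)$; this is an equivalence relation. The $\sigma$-classes of $\bar f$ are the corresponding equivalence classes in $\{\bar f_1,\dots,\bar f_n\}$, where $\bar f_i,\bar f_j$ are in the same class when $i\sim j$. *)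

theory Defs
  imports "HOL-Analysis.Analysis" "HOL-Algebra.Sym_Groups"
begin

section \<open>Finite polyhedra\<close>

text \<open>The constant \<open>polyhedron\<close> of the library means a convex set cut out by finitely many
  half-spaces.  Here a finite polyhedron is the underlying space of a finite simplicial complex
  (finiteness is part of \<^const>\<open>simplicial_complex\<close>).\<close>

definition finite_polyhedron :: "'a::euclidean_space set \<Rightarrow> bool" where
  "finite_polyhedron X \<longleftrightarrow> (\<exists>K. simplicial_complex K \<and> X = \<Union>K)"


section \<open>Configuration spaces and multivalued maps\<close>

definition quotient_topology :: "'a topology \<Rightarrow> ('a \<Rightarrow> 'b) \<Rightarrow> 'b topology" where
  "quotient_topology Y q =
     topology (\<lambda>U. U \<subseteq> q ` topspace Y \<and> openin Y {y \<in> topspace Y. q y \<in> U})"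

lemma openin_quotient_topology:
  "openin (quotient_topology Y q) U \<longleftrightarrow>
     U \<subseteq> q ` topspace Y \<and> openin Y {y \<in> topspace Y. q y \<in> U}"
proof -
  have "istopology (\<lambda>U. U \<subseteq> q ` topspace Y \<and> openin Y {y \<in> topspace Y. q y \<in> U})"
    unfolding istopology_def
  proof (intro conjI allI impI)
    fix S T
    assume "S \<subseteq> q ` topspace Y \<and> openin Y {y \<in> topspace Y. q y \<in> S}"
      and "T \<subseteq> q ` topspace Y \<and> openin Y {y \<in> topspace Y. q y \<in> T}"
    moreover have "{y \<in> topspace Y. q y \<in> S \<inter> T} =
        {y \<in> topspace Y. q y \<in> S} \<inter> {y \<in> topspace Y. q y \<in> T}" by auto
    ultimately show "S \<inter> T \<subseteq> q ` topspace Y" "openin Y {y \<in> topspace Y. q y \<in> S \<inter> T}"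
      by auto
  next
    fix \<K>
    assume K: "\<forall>U\<in>\<K>. U \<subseteq> q ` topspace Y \<and> openin Y {y \<in> topspace Y. q y \<in> U}"
    then show "\<Union>\<K> \<subseteq> q ` topspace Y" by blast
    have "{y \<in> topspace Y. q y \<in> \<Union>\<K>} = (\<Union>U\<in>\<K>. {y \<in> topspace Y. q y \<in> U})" by auto
    then show "openin Y {y \<in> topspace Y. q y \<in> \<Union>\<K>}" using K by auto
  qed
  then show ?thesis by (simp add: quotient_topology_def)
qed

lemma topspace_quotient_topology: "topspace (quotient_topology Y q) = q ` topspace Y"
proof -
  have "{y \<in> topspace Y. q y \<in> q ` topspace Y} = topspace Y" by auto
  then have "openin (quotient_topology Y q) (q ` topspace Y)"
    by (simp add: openin_quotient_topology)
  then show ?thesis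
    by (metis openin_quotient_topology openin_subset openin_topspace subset_antisym)
qed

lemma quotient_map_quotient_topology: "quotient_map Y (quotient_topology Y q) q"
  by (auto simp: quotient_map_def topspace_quotient_topology openin_quotient_topology)

text \<open>Points of \<open>Y\<^sup>n\<close> are functions on the index set \<open>{1..n}\<close>
  (extended by \<^const>\<open>undefined\<close>, as in \<^const>\<open>product_topology\<close>).\<close>

definition config_space :: "nat \<Rightarrow> 'a topology \<Rightarrow> (nat \<Rightarrow> 'a) topology" where
  "config_space n Y =
     subtopology (product_topology (\<lambda>_. Y) {1..n}) {y. inj_on y {1..n}}"

text \<open>The fibres of \<open>forget_order n\<close> on \<open>config_space n Y\<close> are exactly the orbits of the
  symmetric group, so the quotient by it is carried by the \<open>n\<close>-element subsets of \<open>Y\<close>.\<close>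

definition forget_order :: "nat \<Rightarrow> (nat \<Rightarrow> 'a) \<Rightarrow> 'a set" where
  "forget_order n y = y ` {1..n}"

definition unordered_config_space :: "nat \<Rightarrow> 'a topology \<Rightarrow> 'a set topology" where
  "unordered_config_space n Y = quotient_topology (config_space n Y) (forget_order n)"

definition multivalued_map ::
    "nat \<Rightarrow> 'a::topological_space set \<Rightarrow> ('a \<Rightarrow> 'a set) \<Rightarrow> bool" where
  "multivalued_map n X f \<longleftrightarrow>
     continuous_map (top_of_set X) (unordered_config_space n (top_of_set X)) f"

definition submap ::
    "'a::topological_space set \<Rightarrow> nat \<Rightarrow> ('a \<Rightarrow> 'a set) \<Rightarrow> nat \<Rightarrow> ('a \<Rightarrow> 'a set) \<Rightarrow> bool" where
  "submap X n f k g \<longleftrightarrow>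
     1 \<le> k \<and> k \<le> n \<and> multivalued_map k X g \<and> (\<forall>x\<in>X. g x \<subseteq> f x)"

definition irreducible_map ::
    "'a::topological_space set \<Rightarrow> nat \<Rightarrow> ('a \<Rightarrow> 'a set) \<Rightarrow> bool" where
  "irreducible_map X n f \<longleftrightarrow> \<not> (\<exists>k h. k < n \<and> submap X n f k h)"


section \<open>The fundamental group and its action on the universal covering\<close>

definition universal_covering ::
    "'c::topological_space set \<Rightarrow> ('c \<Rightarrow> 'a) \<Rightarrow> 'a::topological_space set \<Rightarrow> bool" where
  "universal_covering C p X \<longleftrightarrow> covering_space C p X \<and> simply_connected C"

definition loops_at :: "'a::topological_space set \<Rightarrow> 'a \<Rightarrow> (real \<Rightarrow> 'a) set" where
  "loops_at X x0 =
     {l. path l \<and> path_image l \<subseteq> X \<and> pathstart l = x0 \<and> pathfinish l = x0}"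

definition loop_class ::
    "'a::topological_space set \<Rightarrow> (real \<Rightarrow> 'a) \<Rightarrow> (real \<Rightarrow> 'a) set" where
  "loop_class X l = {m. homotopic_paths X l m}"

definition fundamental_group ::
    "'a::topological_space set \<Rightarrow> 'a \<Rightarrow> (real \<Rightarrow> 'a) set monoid" where
  "fundamental_group X x0 =
     \<lparr> carrier = loop_class X ` loops_at X x0,
       mult = (\<lambda>\<alpha> \<beta>. \<Union>l\<in>\<alpha>. \<Union>m\<in>\<beta>. loop_class X (l +++ m)),
       one = loop_class X (\<lambda>_. x0) \<rparr>"

definition covering_transformation ::
    "'c::topological_space set \<Rightarrow> ('c \<Rightarrow> 'a) \<Rightarrow> ('c \<Rightarrow> 'c) \<Rightarrow> bool" where
  "covering_transformation C p h \<longleftrightarrow>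
     (\<exists>h'. homeomorphism C C h h') \<and> (\<forall>x\<in>C. p (h x) = p x)"

text \<open>The standard action determined by a base point \<open>xt\<close> of \<open>C\<close>: a class \<open>\<alpha>\<close> acts as the
  covering transformation carrying \<open>xt\<close> to the end point of the lift \<open>m\<close>, starting at \<open>xt\<close>, of
  any loop \<open>l\<close> representing \<open>\<alpha>\<close>.  For a universal covering of a connected, locally path
  connected space this determines \<open>act \<alpha>\<close> uniquely on \<open>C\<close>, and it is a left action of the
  fundamental group for the product of loops in the order of traversal.\<close>

definition covering_action ::
    "'c::topological_space set \<Rightarrow> ('c \<Rightarrow> 'a) \<Rightarrow> 'a::topological_space set \<Rightarrow> 'c
      \<Rightarrow> ((real \<Rightarrow> 'a) set \<Rightarrow> 'c \<Rightarrow> 'c) \<Rightarrow> bool" where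
  "covering_action C p X xt act \<longleftrightarrow>
     (\<forall>\<alpha> \<in> carrier (fundamental_group X (p xt)).
        covering_transformation C p (act \<alpha>) \<and>
        (\<forall>l\<in>\<alpha>. \<forall>m. path m \<and> path_image m \<subseteq> C \<and> pathstart m = xt \<and> (\<forall>t\<in>{0..1}. p (m t) = l t)
           \<longrightarrow> act \<alpha> xt = pathfinish m))"


section \<open>Liftings\<close>

definition orbit_config_space ::
    "nat \<Rightarrow> 'c::topological_space set \<Rightarrow> ('c \<Rightarrow> 'a) \<Rightarrow> (nat \<Rightarrow> 'c) topology" where
  "orbit_config_space n C p =
     subtopology (product_topology (\<lambda>_. top_of_set C) {1..n}) {y. inj_on (p \<circ> y) {1..n}}"

definition orbit_projection :: "nat \<Rightarrow> ('c \<Rightarrow> 'a) \<Rightarrow> (nat \<Rightarrow> 'c) \<Rightarrow> 'a set" where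
  "orbit_projection n p y = forget_order n (p \<circ> y)"

definition lifting ::
    "'c::topological_space set \<Rightarrow> ('c \<Rightarrow> 'a) \<Rightarrow> nat \<Rightarrow> ('a \<Rightarrow> 'a set) \<Rightarrow> ('c \<Rightarrow> nat \<Rightarrow> 'c) \<Rightarrow> bool"
  where
  "lifting C p n f F \<longleftrightarrow>
     continuous_map (top_of_set C) (orbit_config_space n C p) F \<and>
     (\<forall>x\<in>C. orbit_projection n p (F x) = f (p x))"

definition basic_lifting ::
    "'c::topological_space set \<Rightarrow> ('c \<Rightarrow> 'a) \<Rightarrow> 'c \<Rightarrow> (nat \<Rightarrow> 'c) \<Rightarrow> nat \<Rightarrow> ('a \<Rightarrow> 'a set)
      \<Rightarrow> ('c \<Rightarrow> nat \<Rightarrow> 'c) \<Rightarrow> bool" where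
  "basic_lifting C p xt yt n f F \<longleftrightarrow>
     xt \<in> C \<and> yt \<in> topspace (orbit_config_space n C p) \<and> orbit_projection n p yt = f (p xt) \<and>
     lifting C p n f F \<and> F xt = yt"

definition lift_coordinate :: "('c \<Rightarrow> nat \<Rightarrow> 'c) \<Rightarrow> nat \<Rightarrow> 'c \<Rightarrow> 'c" where
  "lift_coordinate F i = (\<lambda>x. F x i)"

text \<open>\<open>G\<close> is the group acting through \<open>act\<close>.  In the equation, \<open>inv_into UNIV (\<sigma> \<alpha>)\<close> is the
  inverse permutation of \<open>\<sigma> \<alpha>\<close>.\<close>

definition lifting_equivariance ::
    "('g, 'b) monoid_scheme \<Rightarrow> ('g \<Rightarrow> 'c \<Rightarrow> 'c) \<Rightarrow> 'c set \<Rightarrow> nat \<Rightarrow> ('c \<Rightarrow> nat \<Rightarrow> 'c)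
      \<Rightarrow> (nat \<Rightarrow> 'g \<Rightarrow> 'g) \<Rightarrow> ('g \<Rightarrow> nat \<Rightarrow> nat) \<Rightarrow> bool" where
  "lifting_equivariance G act C n F \<phi> \<sigma> \<longleftrightarrow>
     \<sigma> \<in> hom G (sym_group n) \<and>
     (\<forall>i\<in>{1..n}. \<phi> i \<in> carrier G \<rightarrow> carrier G) \<and>
     (\<forall>\<alpha>\<in>carrier G. \<forall>x\<in>C. \<forall>i\<in>{1..n}.
        lift_coordinate F i (act \<alpha> x)
          = act (\<phi> i \<alpha>) (lift_coordinate F (inv_into UNIV (\<sigma> \<alpha>) i) x))"

definition sigma_rel ::
    "('g, 'b) monoid_scheme \<Rightarrow> nat \<Rightarrow> ('g \<Rightarrow> nat \<Rightarrow> nat) \<Rightarrow> (nat \<times> nat) set" where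
  "sigma_rel G n \<sigma> = {(i, j) \<in> {1..n} \<times> {1..n}. \<exists>\<gamma>\<in>carrier G. \<sigma> \<gamma> j = i}"

definition sigma_classes ::
    "('g, 'b) monoid_scheme \<Rightarrow> nat \<Rightarrow> ('g \<Rightarrow> nat \<Rightarrow> nat) \<Rightarrow> ('c \<Rightarrow> nat \<Rightarrow> 'c) \<Rightarrow> ('c \<Rightarrow> 'c) set set" where
  "sigma_classes G n \<sigma> F = {lift_coordinate F ` I | I. I \<in> {1..n} // sigma_rel G n \<sigma>}"

end

theory Submission
  imports Defs
begin

text \<open>For \<open>x \<in> C\<close> let \<open>I x\<close> be the set of indices \<open>i\<close> with \<open>p (F x i) \<in> g (p x)\<close>. It has exactly \<open>k\<close>
  elements, and each of its members persists near \<open>x\<close>, so \<open>I\<close> is locally constant, hence constant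
  on the connected space \<open>C\<close>; enumerating it gives the lifting of \<open>g\<close>. The equivariance of \<open>F\<close>
  shows that \<open>I\<close> is a union of \<open>\<sigma>\<close>-orbits. For a single orbit \<open>J\<close>, the set
  \<open>{p (F x j) | j \<in> J}\<close> depends only on \<open>p x\<close>, because the fundamental group acts transitively
  on fibres, so \<open>J\<close> defines a submap of \<open>g\<close>; if \<open>g\<close> is irreducible then \<open>J = I\<close>.\<close>

section \<open>Coverings and the action on a fibre\<close>

text \<open>The library proves these facts about coverings only for metric or normed total spaces.\<close>

lemma covering_space_evenly_covered:
  assumes "covering_space C p X" "y \<in> X"
  obtains T v where "y \<in> T" "openin (top_of_set X) T" "\<Union>v = C \<inter> p -` T"
    "\<And>u. u \<in> v \<Longrightarrow> openin (top_of_set C) u" "pairwise disjnt v"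
    "\<And>u. u \<in> v \<Longrightarrow> \<exists>q. homeomorphism u T p q"
proof -
  from assms have "\<exists>T. y \<in> T \<and> openin (top_of_set X) T \<and>
      (\<exists>v. \<Union>v = C \<inter> p -` T \<and> (\<forall>u\<in>v. openin (top_of_set C) u) \<and> pairwise disjnt v \<and>
         (\<forall>u\<in>v. \<exists>q. homeomorphism u T p q))"
    unfolding covering_space_def by (elim conjE) (rule bspec)
  then obtain T v where T: "y \<in> T" "openin (top_of_set X) T" "\<Union>v = C \<inter> p -` T"
      "\<forall>u\<in>v. openin (top_of_set C) u" "pairwise disjnt v" "\<forall>u\<in>v. \<exists>q. homeomorphism u T p q"
    by (elim exE conjE)
  show thesis by (rule that[OF T(1-3) _ T(5)]) (rule bspec[OF T(4)] bspec[OF T(6)], assumption)+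
qed

text \<open>A covering projection is open: each point of \<open>U\<close> lies in a sheet, where
  \<open>p\<close> is a homeomorphism onto an open set. A continuous open surjection is a quotient
  map.\<close>

lemma covering_space_quotient_map:
  fixes C :: "'c::topological_space set" and X :: "'a::topological_space set"
  assumes "covering_space C p X"
  shows "quotient_map (top_of_set C) (top_of_set X) p"
proof (rule continuous_open_imp_quotient_map)
  have im: "p ` C = X" and cont: "continuous_on C p"
    using assms by (auto simp: covering_space_def)
  then show "continuous_map (top_of_set C) (top_of_set X) p" by auto
  show "p ` topspace (top_of_set C) = topspace (top_of_set X)" using im by simp
  show "open_map (top_of_set C) (top_of_set X) p"
    unfolding open_map_def
  proof (intro allI impI, subst openin_subopen, intro ballI)
    fix U assume U: "openin (top_of_set C) U"
    fix y assume "y \<in> p ` U"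
    then obtain x where x: "x \<in> U" "y = p x" by blast
    then have "x \<in> C" using U openin_imp_subset by blast
    then have "y \<in> X" using im x by blast
    then obtain T v where T: "y \<in> T" "openin (top_of_set X) T" "\<Union>v = C \<inter> p -` T"
      and v: "\<And>u. u \<in> v \<Longrightarrow> openin (top_of_set C) u"
      and hom: "\<And>u. u \<in> v \<Longrightarrow> \<exists>q. homeomorphism u T p q"
      by (rule covering_space_evenly_covered[OF assms]) blast
    have "x \<in> \<Union>v" using T \<open>x \<in> C\<close> x by simp
    then obtain u where u: "u \<in> v" "x \<in> u" by blast
    obtain q where q: "homeomorphism u T p q" using hom[OF u(1)] by blast
    \<comment> \<open>Openness of \<open>U\<close> in \<open>C\<close> is passed to the sheet
      \<open>u\<close>, since the homeomorphism is defined on \<open>u\<close> alone.\<close>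
    obtain A where "open A" "U = C \<inter> A" using U by (auto simp: openin_open)
    moreover have "u \<subseteq> C" using v[OF u(1)] openin_imp_subset by blast
    ultimately have "u \<inter> U = u \<inter> A" by blast
    with \<open>open A\<close> have "openin (top_of_set u) (u \<inter> U)" by (simp add: openin_open_Int)
    then have "openin (top_of_set T) (p ` (u \<inter> U))"
      by (rule homeomorphism_imp_open_map[OF q])
    then have "openin (top_of_set X) (p ` (u \<inter> U))"
      using T(2) openin_trans by blast
    then show "\<exists>V. openin (top_of_set X) V \<and> y \<in> V \<and> V \<subseteq> p ` U"
      using u x by (intro exI[of _ "p ` (u \<inter> U)"]) auto
  qed
qed

text \<open>Simple connectedness makes any two loops freely homotopic. For the constant loops at
  \<open>x\<close> and \<open>y\<close>, the homotopy at parameter 0 traces a path from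
  \<open>x\<close> to \<open>y\<close>.\<close>

lemma simply_connected_imp_path_connected_topological:
  fixes C :: "'c::topological_space set"
  assumes "simply_connected C"
  shows "path_connected C"
  unfolding path_connected_component
proof (intro ballI)
  fix x y assume "x \<in> C" "y \<in> C"
  then have "homotopic_loops C (\<lambda>_. x) (\<lambda>_. y)"
    using assms[unfolded simply_connected_def, rule_format, of "\<lambda>_. x" "\<lambda>_. y"]
    by (auto simp: path_def pathstart_def pathfinish_def path_image_def)
  then show "path_component C x y"
    using homotopic_loops_imp_path_component_value[of C "\<lambda>_. x" "\<lambda>_. y" 0] by simp
qed

text \<open>The sheet \<open>u\<close> and the union of the other sheets are disjoint open subsets
  of \<open>C\<close> covering \<open>K\<close>, so a connected \<open>K\<close> that meets
  \<open>u\<close> cannot meet the rest.\<close>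

lemma connected_subset_sheet:
  fixes C :: "'c::topological_space set"
  assumes K: "connected K" "K \<subseteq> \<Union>v" "y \<in> K" "y \<in> u"
    and v: "u \<in> v" "\<And>u. u \<in> v \<Longrightarrow> openin (top_of_set C) u" "pairwise disjnt v"
  shows "K \<subseteq> u"
proof -
  have "openin (top_of_set C) (\<Union>(v - {u}))" using v(2) by (intro openin_Union) auto
  then obtain B where B: "open B" "\<Union>(v - {u}) = C \<inter> B" unfolding openin_open by (elim exE conjE)
  obtain A where A: "open A" "u = C \<inter> A"
    using v(2)[OF v(1)] unfolding openin_open by (elim exE conjE)
  have "K \<subseteq> u \<union> \<Union>(v - {u})" using K by blast
  then have "K \<subseteq> A \<union> B" and KC: "K \<subseteq> C" using A B by auto
  moreover have "u \<inter> \<Union>(v - {u}) = {}"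
    using v(1,3) unfolding pairwise_def disjnt_def by blast
  then have "A \<inter> B \<inter> K = {}" using A B KC by blast
  ultimately have "B \<inter> K = {}"
    using connectedD[OF K(1) A(1) B(1)] K(3,4) A(2) by blast
  then show ?thesis using \<open>K \<subseteq> A \<union> B\<close> A(2) KC by blast
qed

lemma covering_action_deck:
  assumes "covering_action C p X xt act" "\<alpha> \<in> carrier (fundamental_group X (p xt))"
  shows "act \<alpha> ` C = C" "continuous_on C (act \<alpha>)" "\<And>x. x \<in> C \<Longrightarrow> p (act \<alpha> x) = p x"
proof -
  have "covering_transformation C p (act \<alpha>)"
    using assms unfolding covering_action_def by blast
  then show "act \<alpha> ` C = C" "continuous_on C (act \<alpha>)" "\<And>x. x \<in> C \<Longrightarrow> p (act \<alpha> x) = p x"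
    by (auto simp: covering_transformation_def homeomorphism_def)
qed

text \<open>No path lifting is needed: over the base point, a path between two points of the fibre
  is itself the lift of the loop it projects to. Transitivity on fibres then spreads along a path
  of the total space, since over an evenly covered set a translate of a short piece of the path
  cannot leave its sheet.\<close>

lemma covering_action_transitive:
  fixes C :: "'c::topological_space set" and p :: "'c \<Rightarrow> 'a::topological_space"
  assumes uc: "universal_covering C p X" and ca: "covering_action C p X xt act"
    and xt: "xt \<in> C" and x: "x \<in> C" "x' \<in> C" "p x' = p x"
  shows "\<exists>\<alpha>\<in>carrier (fundamental_group X (p xt)). x' = act \<alpha> x"
proof -
  let ?G = "carrier (fundamental_group X (p xt))"
  \<comment> \<open>\<open>trans z\<close> says that every point of the fibre through
    \<open>z\<close> is a translate of \<open>z\<close>. It is proved at \<open>xt\<close> and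
    carried along a path to \<open>x\<close>.\<close>
  define trans where "trans z \<longleftrightarrow> (\<forall>z'\<in>C. p z' = p z \<longrightarrow> (\<exists>\<alpha>\<in>?G. z' = act \<alpha> z))" for z
  have cov: "covering_space C p X" and pc: "path_connected C"
    using uc simply_connected_imp_path_connected_topological by (auto simp: universal_covering_def)
  have contp: "continuous_on C p" and im: "p ` C = X"
    using cov by (auto simp: covering_space_def)
  have deck: "act \<alpha> ` C = C" "continuous_on C (act \<alpha>)" "\<And>z. z \<in> C \<Longrightarrow> p (act \<alpha> z) = p z"
    if "\<alpha> \<in> ?G" for \<alpha>
    using covering_action_deck[OF ca that] by auto
  have base: "trans xt"
    unfolding trans_def
  proof (intro ballI impI)
    fix z assume z: "z \<in> C" "p z = p xt"
    obtain m where m: "path m" "path_image m \<subseteq> C" "pathstart m = xt" "pathfinish m = z"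
      using pc xt z unfolding path_connected_def by blast
    have l: "path (p \<circ> m)" "path_image (p \<circ> m) \<subseteq> X"
      using path_continuous_image[OF m(1) continuous_on_subset[OF contp m(2)]] m(2) im
      by (auto simp: path_image_compose)
    then have loop: "p \<circ> m \<in> loops_at X (p xt)"
      using m z by (auto simp: loops_at_def pathstart_def pathfinish_def)
    let ?\<alpha> = "loop_class X (p \<circ> m)"
    have \<alpha>: "?\<alpha> \<in> ?G" using loop by (simp add: fundamental_group_def)
    have "p \<circ> m \<in> ?\<alpha>" using l by (simp add: loop_class_def)
    moreover have "\<forall>l\<in>?\<alpha>. \<forall>m. path m \<and> path_image m \<subseteq> C \<and> pathstart m = xt \<and>
        (\<forall>t\<in>{0..1}. p (m t) = l t) \<longrightarrow> act ?\<alpha> xt = pathfinish m"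
      using ca[unfolded covering_action_def, rule_format, OF \<alpha>] by (rule conjunct2)
    \<comment> \<open>The path \<open>m\<close> lifts the representative \<open>p \<circ> m\<close>
      of the class and starts at \<open>xt\<close>, so its end \<open>z\<close> is the translate of
      \<open>xt\<close>.\<close>
    ultimately have "act ?\<alpha> xt = pathfinish m"
      using m by (metis comp_apply)
    then show "\<exists>\<alpha>\<in>?G. z = act \<alpha> xt" using m \<alpha> by metis
  qed
  obtain \<gamma> where \<gamma>: "path \<gamma>" "path_image \<gamma> \<subseteq> C" "pathstart \<gamma> = xt" "pathfinish \<gamma> = x"
    using pc xt x unfolding path_connected_def by blast
  have \<gamma>C: "\<gamma> t \<in> C" if "t \<in> {0..1}" for t using \<gamma> that by (auto simp: path_image_def)
  have cont\<gamma>: "continuous_on {0..1} \<gamma>" using \<gamma> by (simp add: path_def)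
  have "trans (\<gamma> 1)"
  proof (rule connected_induction_simple[of "{0..1::real}" 0 1 "\<lambda>t. trans (\<gamma> t)"])
    show "trans (\<gamma> 0)" using base \<gamma> by (simp add: pathstart_def)
    fix t :: real assume t: "t \<in> {0..1}"
    then have "p (\<gamma> t) \<in> X" using \<gamma>C im by blast
    then obtain T v where T: "p (\<gamma> t) \<in> T" "openin (top_of_set X) T" "\<Union>v = C \<inter> p -` T"
      and v: "\<And>u. u \<in> v \<Longrightarrow> openin (top_of_set C) u" "pairwise disjnt v"
      and hom: "\<And>u. u \<in> v \<Longrightarrow> \<exists>q. homeomorphism u T p q"
      by (rule covering_space_evenly_covered[OF cov]) blast
    have "continuous_on {0..1} (p \<circ> \<gamma>)"
      using cont\<gamma> \<gamma>(2) continuous_on_subset[OF contp] unfolding path_image_def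
      by (intro continuous_on_compose)
    moreover have "p \<circ> \<gamma> \<in> {0..1} \<rightarrow> X" using \<gamma>C im by auto
    ultimately have "openin (top_of_set {0..1}) ({0..1} \<inter> (p \<circ> \<gamma>) -` T)"
      using T(2) continuous_openin_preimage by blast
    then obtain e where e: "e > 0" "ball t e \<inter> {0..1} \<subseteq> (p \<circ> \<gamma>) -` T"
      using t T(1) unfolding openin_contains_ball by (metis IntI comp_apply le_inf_iff vimageI)
    let ?N = "{0..1} \<inter> ball t e"
    have N: "connected ?N" by (intro convex_connected convex_Int) auto
    have NT: "p (\<gamma> s) \<in> T" if "s \<in> ?N" for s using that e by auto
    \<comment> \<open>Both \<open>s\<close> and \<open>r\<close> are arbitrary in \<open>?N\<close>,
      as connected induction requires. The property must spread in either direction.\<close>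
    have spread: "trans (\<gamma> r)" if s: "s \<in> ?N" and r: "r \<in> ?N" and ts: "trans (\<gamma> s)" for s r
      unfolding trans_def
    proof (intro ballI impI)
      fix z assume z: "z \<in> C" "p z = p (\<gamma> r)"
      then have "z \<in> \<Union>v" using T(3) NT[OF r] by simp
      then obtain u where u: "u \<in> v" "z \<in> u" by blast
      then obtain q where q: "homeomorphism u T p q" using hom by blast
      \<comment> \<open>\<open>w\<close> is the point over \<open>p (\<gamma> s)\<close> in the
        sheet of \<open>z\<close>. The translate of the piece of \<open>\<gamma>\<close> through
        \<open>w\<close> stays in that sheet, and injectivity of \<open>p\<close> there identifies
        its point over \<open>p (\<gamma> r)\<close> with \<open>z\<close>.\<close>
      obtain w where w: "w \<in> u" "p w = p (\<gamma> s)"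
        using homeomorphism_image1[OF q] NT[OF s] by (metis imageE)
      then have "w \<in> C" using u T(3) by blast
      then obtain \<alpha> where \<alpha>: "\<alpha> \<in> ?G" "w = act \<alpha> (\<gamma> s)" using ts w unfolding trans_def by blast
      let ?K = "act \<alpha> ` \<gamma> ` ?N"
      have sub: "\<gamma> ` ?N \<subseteq> C" using \<gamma>C by blast
      have "continuous_on ?N \<gamma>" using cont\<gamma> continuous_on_subset by blast
      then have "connected ?K"
        by (intro connected_continuous_image continuous_on_subset[OF deck(2)[OF \<alpha>(1)] sub] N)
      moreover have "?K \<subseteq> \<Union>v"
        unfolding T(3) using sub deck(1,3)[OF \<alpha>(1)] NT by auto
      ultimately have "?K \<subseteq> u"
      proof (rule connected_subset_sheet[of _ _ w _ C])
        show "w \<in> ?K" using \<alpha> s by blast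
      qed (use u w v in auto)
      then have "act \<alpha> (\<gamma> r) \<in> u" using r by blast
      moreover have "p (act \<alpha> (\<gamma> r)) = p z" using deck(3)[OF \<alpha>(1)] \<gamma>C r z by simp
      ultimately have "z = act \<alpha> (\<gamma> r)"
        using u q by (metis homeomorphism_apply1)
      then show "\<exists>\<alpha>\<in>?G. z = act \<alpha> (\<gamma> r)" using \<alpha> by blast
    qed
    show "\<exists>T. openin (top_of_set {0..1}) T \<and> t \<in> T \<and>
            (\<forall>x\<in>T. \<forall>y\<in>T. trans (\<gamma> x) \<longrightarrow> trans (\<gamma> y))"
    proof (intro exI[of _ ?N] conjI ballI impI)
      show "openin (top_of_set {0..1}) ?N" by (intro openin_open_Int open_ball)
      show "t \<in> ?N" using t e(1) by simp
      show "trans (\<gamma> r)" if "s \<in> ?N" "r \<in> ?N" "trans (\<gamma> s)" for s r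
        by (rule spread[OF that])
    qed
  qed auto
  then show ?thesis using x \<gamma> unfolding trans_def pathfinish_def by simp
qed

text \<open>The product is a union over all pairs of representatives. Joining respects homotopy, so
  all members of the union are one and the same class.\<close>

lemma fundamental_group_mult_closed:
  assumes "\<alpha> \<in> carrier (fundamental_group X x0)" "\<beta> \<in> carrier (fundamental_group X x0)"
  shows "\<alpha> \<otimes>\<^bsub>fundamental_group X x0\<^esub> \<beta> \<in> carrier (fundamental_group X x0)"
proof -
  obtain l m where l: "l \<in> loops_at X x0" "\<alpha> = loop_class X l"
    and m: "m \<in> loops_at X x0" "\<beta> = loop_class X m"
    using assms by (auto simp: fundamental_group_def)
  have eq: "loop_class X (l' +++ m') = loop_class X (l +++ m)" if "l' \<in> \<alpha>" "m' \<in> \<beta>" for l' m'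
  proof -
    have "homotopic_paths X (l +++ m) (l' +++ m')"
      using that l m by (intro homotopic_paths_join) (auto simp: loop_class_def loops_at_def)
    then show ?thesis
      unfolding loop_class_def
      by (intro Collect_cong) (meson homotopic_paths_sym homotopic_paths_trans)
  qed
  \<comment> \<open>Both classes are nonempty, so the union of the constant family is that constant
    class.\<close>
  have "l \<in> \<alpha>" "m \<in> \<beta>" using l m by (auto simp: loop_class_def loops_at_def)
  moreover have "(\<Union>l'\<in>\<alpha>. \<Union>m'\<in>\<beta>. loop_class X (l' +++ m')) =
      (\<Union>l'\<in>\<alpha>. \<Union>m'\<in>\<beta>. loop_class X (l +++ m))"
    by (intro SUP_cong refl eq)
  ultimately have "(\<Union>l'\<in>\<alpha>. \<Union>m'\<in>\<beta>. loop_class X (l' +++ m')) = loop_class X (l +++ m)"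
    by auto
  moreover have "l +++ m \<in> loops_at X x0"
    using l m by (auto simp: loops_at_def path_image_join)
  ultimately show ?thesis by (simp add: fundamental_group_def)
qed

section \<open>Multivalued maps\<close>

lemma card_unordered_config:
  assumes "S \<in> topspace (unordered_config_space n Y)"
  shows "card S = n"
  using assms
  by (auto simp: unordered_config_space_def topspace_quotient_topology config_space_def
      forget_order_def card_image)

text \<open>Upstairs, meeting \<open>U\<close> means that some coordinate lies in \<open>U\<close>:
  a union of preimages under coordinate projections.\<close>

lemma openin_unordered_config_meets:
  assumes "openin Y U"
  shows "openin (unordered_config_space n Y)
           {S \<in> topspace (unordered_config_space n Y). S \<inter> U \<noteq> {}}" (is "openin _ ?V")
proof -
  let ?c = "config_space n Y"
  have "{y \<in> topspace ?c. forget_order n y \<in> ?V} = (\<Union>j\<in>{1..n}. {y \<in> topspace ?c. y j \<in> U})"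
    unfolding unordered_config_space_def topspace_quotient_topology
    by (auto simp: forget_order_def)
  moreover have "openin ?c {y \<in> topspace ?c. y j \<in> U}" if "j \<in> {1..n}" for j
    using assms continuous_map_from_subtopology[OF continuous_map_product_projection[OF that]]
    unfolding config_space_def by (intro openin_continuous_map_preimage)
  ultimately show ?thesis
    unfolding unordered_config_space_def openin_quotient_topology topspace_quotient_topology
    by auto
qed

text \<open>An enumeration of \<open>J\<close> turns the family into a continuous map to ordered
  configurations. Forgetting the order is continuous and removes the dependence on the
  enumeration.\<close>

lemma continuous_map_unordered_config:
  assumes J: "finite J" and cont: "\<And>j. j \<in> J \<Longrightarrow> continuous_map Z Y (a j)"
    and inj: "\<And>z. z \<in> topspace Z \<Longrightarrow> inj_on (\<lambda>j. a j z) J"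
  shows "continuous_map Z (unordered_config_space (card J) Y) (\<lambda>z. (\<lambda>j. a j z) ` J)"
proof -
  obtain e where e: "bij_betw e {1..card J} J"
    by (rule exE[OF ex_bij_betw_nat_finite_1[OF J]])
  have eJ: "e i \<in> J" if "i \<in> {1..card J}" for i by (rule bij_betw_apply[OF e that])
  let ?b = "\<lambda>z. \<lambda>i\<in>{1..card J}. a (e i) z"
  have "continuous_map Z (product_topology (\<lambda>_. Y) {1..card J}) ?b"
    unfolding continuous_map_componentwise
  proof (intro conjI ballI)
    show "?b ` topspace Z \<subseteq> extensional {1..card J}" by auto
    show "continuous_map Z Y (\<lambda>z. ?b z i)" if "i \<in> {1..card J}" for i
      using cont[OF eJ[OF that]] that by simp
  qed
  moreover have "inj_on (?b z) {1..card J}" if "z \<in> topspace Z" for z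
  proof -
    have "inj_on ((\<lambda>j. a j z) \<circ> e) {1..card J}"
      using comp_inj_on[of e "{1..card J}" "\<lambda>j. a j z"] e inj[OF that]
      by (simp add: bij_betw_def)
    then show ?thesis by (rule iffD2[OF inj_on_cong, rotated]) simp
  qed
  ultimately have "continuous_map Z (config_space (card J) Y) ?b"
    unfolding config_space_def by (intro continuous_map_into_subtopology) auto
  then have "continuous_map Z (unordered_config_space (card J) Y) (forget_order (card J) \<circ> ?b)"
    unfolding unordered_config_space_def
    by (rule continuous_map_compose[OF _ quotient_imp_continuous_map[OF quotient_map_quotient_topology]])
  moreover have "forget_order (card J) \<circ> ?b = (\<lambda>z. (\<lambda>j. a j z) ` J)"
  proof
    fix z
    have "(forget_order (card J) \<circ> ?b) z = (\<lambda>j. a j z) ` e ` {1..card J}"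
      by (auto simp: forget_order_def)
    then show "(forget_order (card J) \<circ> ?b) z = (\<lambda>j. a j z) ` J"
      using e by (simp add: bij_betw_def)
  qed
  ultimately show ?thesis by simp
qed

text \<open>The finitely many points \<open>a j z\<close> are separated. Near \<open>z\<close>, the
  set \<open>G w\<close> still has a point close to \<open>a i z\<close>; it is some
  \<open>a j w\<close>, which is also close to \<open>a j z\<close>, and separation forces
  \<open>j = i\<close>.\<close>

lemma openin_selected_index:
  fixes a :: "'i \<Rightarrow> 'c \<Rightarrow> 'a::metric_space"
  assumes I: "finite I" "i \<in> I"
    and cont: "\<And>j. j \<in> I \<Longrightarrow> continuous_map Z (top_of_set X) (a j)"
    and inj: "\<And>z. z \<in> topspace Z \<Longrightarrow> inj_on (\<lambda>j. a j z) I"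
    and G: "continuous_map Z (unordered_config_space k (top_of_set X)) G"
    and sub: "\<And>z. z \<in> topspace Z \<Longrightarrow> G z \<subseteq> (\<lambda>j. a j z) ` I"
  shows "openin Z {z \<in> topspace Z. a i z \<in> G z}"
proof (subst openin_subopen, intro ballI)
  fix z assume "z \<in> {z \<in> topspace Z. a i z \<in> G z}"
  then have z: "z \<in> topspace Z" "a i z \<in> G z" by auto
  \<comment> \<open>\<open>d\<close> is a lower bound for the distances from \<open>a i z\<close> to
    the other points, so balls of radius \<open>d/2\<close> about \<open>a i z\<close> and any other
    \<open>a j z\<close> are disjoint.\<close>
  obtain d where d: "d > 0" "\<And>j. j \<in> I \<Longrightarrow> a j z \<noteq> a i z \<Longrightarrow> d \<le> dist (a i z) (a j z)"
    using finite_set_avoid[of "(\<lambda>j. a j z) ` I" "a i z"] I(1) by blast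
  let ?B = "\<lambda>j. X \<inter> ball (a j z) (d/2)"
  have opB: "openin (top_of_set X) (?B j)" for j by (intro openin_open_Int open_ball)
  have aX: "a j w \<in> X" if "j \<in> I" "w \<in> topspace Z" for j w
    using cont[OF that(1)] that(2) by (auto simp: continuous_map_def Pi_iff)
  let ?M = "{w \<in> topspace Z. G w \<in> {S \<in> topspace (unordered_config_space k (top_of_set X)). S \<inter> ?B i \<noteq> {}}}"
  let ?W = "?M \<inter> ((\<Inter>j\<in>I. {w \<in> topspace Z. a j w \<in> ?B j}) \<inter> topspace Z)"
  have "openin Z ?M"
    by (rule openin_continuous_map_preimage[OF G openin_unordered_config_meets[OF opB]])
  moreover have "openin Z ((\<Inter>j\<in>I. {w \<in> topspace Z. a j w \<in> ?B j}) \<inter> topspace Z)"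
    by (rule openin_INT[OF I(1)]) (rule openin_continuous_map_preimage[OF cont opB])
  ultimately have "openin Z ?W" by blast
  moreover have "z \<in> ?W"
  proof -
    have "G z \<in> topspace (unordered_config_space k (top_of_set X))"
      using G z by (auto simp: continuous_map_def Pi_iff)
    moreover have "a i z \<in> G z \<inter> ?B i" using z d aX I by auto
    ultimately show ?thesis using z d aX by auto
  qed
  moreover have "a i w \<in> G w" if w: "w \<in> ?W" for w
  proof -
    obtain b where b: "b \<in> G w" "b \<in> ball (a i z) (d/2)" using w by blast
    then obtain j where j: "j \<in> I" "b = a j w" using sub w by blast
    have "a j w \<in> ball (a j z) (d/2)" using w j by blast
    then have "dist (a i z) (a j z) < d"
      using b j dist_triangle_half_l[of "a i z" "a j w" d "a j z"]
      by (simp add: dist_commute)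
    then have "a j z = a i z" using d(2)[OF j(1)] by force
    then have "j = i" using inj[OF z(1)] j I by (auto simp: inj_on_def)
    then show ?thesis using b j by simp
  qed
  ultimately show "\<exists>T. openin Z T \<and> z \<in> T \<and> T \<subseteq> {z \<in> topspace Z. a i z \<in> G z}"
    by (intro exI[of _ ?W]) auto
qed

text \<open>A map constant on the fibres factors through \<open>p\<close>, and the factor is
  continuous because \<open>p\<close> is a quotient map.\<close>

lemma multivalued_map_descend:
  assumes cov: "covering_space C p X"
    and H: "continuous_map (top_of_set C) (unordered_config_space m (top_of_set X)) H"
    and fibre: "\<And>x x'. x \<in> C \<Longrightarrow> x' \<in> C \<Longrightarrow> p x' = p x \<Longrightarrow> H x' = H x"
  shows "\<exists>h. multivalued_map m X h \<and> (\<forall>x\<in>C. h (p x) = H x)"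
proof (intro exI conjI ballI)
  \<comment> \<open>\<open>inv_into\<close> picks some point of the fibre; by \<open>fibre\<close>
    the choice does not affect the value.\<close>
  let ?h = "\<lambda>y. H (inv_into C p y)"
  show h: "?h (p x) = H x" if "x \<in> C" for x
    using that by (intro fibre) (auto simp: inv_into_into f_inv_into_f)
  have "continuous_map (top_of_set C) (unordered_config_space m (top_of_set X)) (?h \<circ> p)"
    by (rule continuous_map_eq[OF H]) (simp add: h)
  then show "multivalued_map m X ?h"
    unfolding multivalued_map_def
    by (rule continuous_compose_quotient_map[OF covering_space_quotient_map[OF cov]])
qed

theorem theorem4p3:
  fixes X :: "'a::euclidean_space set"
    and C :: "'c::topological_space set" and p :: "'c \<Rightarrow> 'a"
    and f g :: "'a \<Rightarrow> 'a set" and n k :: nat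
    and xt :: 'c and yt :: "nat \<Rightarrow> 'c" and F :: "'c \<Rightarrow> nat \<Rightarrow> 'c"
    and act :: "(real \<Rightarrow> 'a) set \<Rightarrow> 'c \<Rightarrow> 'c"
    and \<phi> :: "nat \<Rightarrow> (real \<Rightarrow> 'a) set \<Rightarrow> (real \<Rightarrow> 'a) set"
    and \<sigma> :: "(real \<Rightarrow> 'a) set \<Rightarrow> nat \<Rightarrow> nat"
  assumes "finite_polyhedron X" and "connected X"
    and "universal_covering C p X"
    and "covering_action C p X xt act"
    and "multivalued_map n X f"
    and "submap X n f k g"
    and "basic_lifting C p xt yt n f F"
    and "lifting_equivariance (fundamental_group X (p xt)) act C n F \<phi> \<sigma>"
  shows "\<exists>\<iota>. \<iota> \<in> {1..k} \<rightarrow> {1..n} \<and>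
             lifting C p k g (\<lambda>x. \<lambda>j\<in>{1..k}. lift_coordinate F (\<iota> j) x) \<and>
             (irreducible_map X k g \<longrightarrow>
                (\<lambda>j. lift_coordinate F (\<iota> j)) ` {1..k}
                  \<in> sigma_classes (fundamental_group X (p xt)) n \<sigma> F)"
proof -
  let ?G = "fundamental_group X (p xt)"

  \<comment> \<open>Projected coordinates of the basic lifting\<close>
  define a where "a j x = p (F x j)" for j x
  have cov: "covering_space C p X" and conC: "connected C"
    using assms(3) simply_connected_imp_path_connected_topological path_connected_imp_connected
    by (auto simp: universal_covering_def)
  have xt: "xt \<in> C" and lift: "lifting C p n f F" using assms(7) by (auto simp: basic_lifting_def)
  have imp: "p ` C = X" and contp: "continuous_map (top_of_set C) (top_of_set X) p"
    using cov by (auto simp: covering_space_def)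
  have Fcont: "continuous_map (top_of_set C) (product_topology (\<lambda>_. top_of_set C) {1..n}) F"
    and Finj: "\<And>x. x \<in> C \<Longrightarrow> inj_on (\<lambda>j. a j x) {1..n}"
    and Ff: "\<And>x. x \<in> C \<Longrightarrow> (\<lambda>j. a j x) ` {1..n} = f (p x)"
    using lift
    by (auto simp: lifting_def orbit_config_space_def continuous_map_in_subtopology
        orbit_projection_def forget_order_def a_def comp_def image_subset_iff Pi_iff)
  have Fj: "continuous_map (top_of_set C) (top_of_set C) (\<lambda>x. F x j)" if "j \<in> {1..n}" for j
    using Fcont that unfolding continuous_map_componentwise by blast
  have acont: "continuous_map (top_of_set C) (top_of_set X) (a j)" if "j \<in> {1..n}" for j
    using continuous_map_compose[OF Fj[OF that] contp] by (simp add: a_def[abs_def] comp_def)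
  have k: "1 \<le> k" and g: "multivalued_map k X g" and gf: "\<And>x. x \<in> X \<Longrightarrow> g x \<subseteq> f x"
    using assms(6) by (auto simp: submap_def)
  have gpcont: "continuous_map (top_of_set C) (unordered_config_space k (top_of_set X)) (\<lambda>x. g (p x))"
    using continuous_map_compose[OF contp g[unfolded multivalued_map_def]] by (simp add: comp_def)
  have gpsub: "g (p x) \<subseteq> (\<lambda>j. a j x) ` {1..n}" if "x \<in> C" for x
    using gf Ff imp that by blast

  \<comment> \<open>The indices selected by \<open>g\<close>\<close>
  define I where "I x = {i \<in> {1..n}. a i x \<in> g (p x)}" for x
  have aI: "(\<lambda>j. a j x) ` I x = g (p x)" if "x \<in> C" for x
    using gpsub[OF that] by (auto simp: I_def)
  have cardI: "card (I x) = k" if x: "x \<in> C" for x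
  proof -
    have "card (g (p x)) = k"
      using card_unordered_config gpcont x by (fastforce simp: continuous_map_def Pi_iff)
    \<comment> \<open>Distinct indices give distinct points, so \<open>I x\<close> is in bijection
      with the \<open>k\<close>-element set \<open>g (p x)\<close>.\<close>
    moreover have "inj_on (\<lambda>j. a j x) (I x)"
      using Finj[OF x] by (rule inj_on_subset) (auto simp: I_def)
    ultimately show ?thesis using aI[OF x] card_image by fastforce
  qed
  have "I constant_on C"
  proof (rule locally_constant_imp_constant[OF conC])
    fix x assume x: "x \<in> C"
    have "finite (I x)" by (simp add: I_def)
    \<comment> \<open>On \<open>?W\<close> all indices selected at \<open>x\<close> remain selected.
      No further index can appear, as the cardinality is always \<open>k\<close>.\<close>
    let ?W = "(\<Inter>i\<in>I x. {z \<in> C. a i z \<in> g (p z)}) \<inter> C"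
    have "openin (top_of_set C) {z \<in> C. a i z \<in> g (p z)}" if "i \<in> I x" for i
      using openin_selected_index[of "{1..n}" i "top_of_set C" X a k "\<lambda>x. g (p x)"]
        that acont Finj gpcont gpsub by (simp add: I_def)
    then have "openin (top_of_set C) ?W"
      using openin_INT[OF \<open>finite (I x)\<close>, of "top_of_set C"] by simp
    moreover have "x \<in> ?W" using x by (auto simp: I_def)
    moreover have "\<forall>z\<in>?W. I z = I x"
    proof
      fix z assume z: "z \<in> ?W"
      have "I x \<subseteq> I z" using z by (auto simp: I_def)
      moreover have "finite (I z)" "card (I z) = card (I x)"
        using cardI x z by (auto simp: I_def)
      ultimately show "I z = I x" by (metis card_subset_eq)
    qed
    ultimately show "\<exists>T. openin (top_of_set C) T \<and> x \<in> T \<and> (\<forall>z\<in>T. I z = I x)"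
      by (intro exI[of _ ?W] conjI)
  qed
  then obtain I0 where I0: "\<And>x. x \<in> C \<Longrightarrow> I x = I0" unfolding constant_on_def by auto
  have I0n: "I0 \<subseteq> {1..n}" and finI0: "finite I0" and cI0: "card I0 = k"
    using I0[OF xt] cardI[OF xt] by (auto simp: I_def)
  obtain \<iota> where \<iota>: "bij_betw \<iota> {1..k} I0"
    by (rule exE[OF ex_bij_betw_nat_finite_1[OF finI0, unfolded cI0]])
  then have \<iota>I0: "\<iota> ` {1..k} = I0" by (simp add: bij_betw_def)
  then have \<iota>n: "\<iota> \<in> {1..k} \<rightarrow> {1..n}" using I0n by auto

  \<comment> \<open>The lifting of the submap\<close>
  have "lifting C p k g (\<lambda>x. \<lambda>j\<in>{1..k}. lift_coordinate F (\<iota> j) x)" (is "lifting _ _ _ _ ?g")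
    unfolding lifting_def
  proof (intro conjI ballI)
    have "continuous_map (top_of_set C) (product_topology (\<lambda>_. top_of_set C) {1..k}) ?g"
      unfolding continuous_map_componentwise
    proof (intro conjI ballI)
      show "?g ` topspace (top_of_set C) \<subseteq> extensional {1..k}" by auto
      show "continuous_map (top_of_set C) (top_of_set C) (\<lambda>x. ?g x j)" if "j \<in> {1..k}" for j
        using Fj[OF funcset_mem[OF \<iota>n that]] that by (simp add: lift_coordinate_def)
    qed
    moreover have "inj_on (p \<circ> ?g x) {1..k}" if x: "x \<in> C" for x
    proof -
      have "inj_on (\<lambda>j. a j x) I0" by (rule inj_on_subset[OF Finj[OF x] I0n])
      then have "inj_on ((\<lambda>j. a j x) \<circ> \<iota>) {1..k}"
        using comp_inj_on[of \<iota> "{1..k}" "\<lambda>j. a j x"] \<iota> by (simp add: bij_betw_def)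
      then show ?thesis
        by (rule iffD2[OF inj_on_cong, rotated]) (simp add: lift_coordinate_def a_def)
    qed
    ultimately show "continuous_map (top_of_set C) (orbit_config_space k C p) ?g"
      unfolding orbit_config_space_def by (intro continuous_map_into_subtopology) auto
    fix x assume x: "x \<in> C"
    have "orbit_projection k p (?g x) = (\<lambda>j. a j x) ` \<iota> ` {1..k}"
      by (auto simp: orbit_projection_def forget_order_def lift_coordinate_def a_def)
    then show "orbit_projection k p (?g x) = g (p x)" using aI[OF x] I0[OF x] \<iota>I0 by simp
  qed

  \<comment> \<open>The irreducible case\<close>
  moreover have "(\<lambda>j. lift_coordinate F (\<iota> j)) ` {1..k} \<in> sigma_classes ?G n \<sigma> F"
    if irr: "irreducible_map X k g"
  proof -
    note eqv = assms(8)[unfolded lifting_equivariance_def]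
    note \<sigma>hom = conjunct1[OF eqv]
      and \<phi>G = conjunct1[OF conjunct2[OF eqv]]
      and Feqv = conjunct2[OF conjunct2[OF eqv], rule_format]
    have perm: "\<sigma> \<alpha> permutes {1..n}" if "\<alpha> \<in> carrier ?G" for \<alpha>
      using \<sigma>hom that by (auto simp: hom_def sym_group_def)
    have hom: "\<sigma> (\<alpha> \<otimes>\<^bsub>?G\<^esub> \<beta>) = \<sigma> \<alpha> \<circ> \<sigma> \<beta>" if "\<alpha> \<in> carrier ?G" "\<beta> \<in> carrier ?G" for \<alpha> \<beta>
      using \<sigma>hom that by (auto simp: hom_def sym_group_def)
    have deck: "act \<alpha> x \<in> C" "p (act \<alpha> x) = p x" if "\<alpha> \<in> carrier ?G" "x \<in> C" for \<alpha> x
      using covering_action_deck[OF assms(4) that(1)] that(2) by auto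
    \<comment> \<open>Applying \<open>p\<close> to the equivariance of \<open>F\<close> removes the
      covering transformation \<open>act (\<phi> i \<alpha>)\<close>; only the permutation of the
      indices remains.\<close>
    have equiv: "a i (act \<alpha> x) = a (inv_into UNIV (\<sigma> \<alpha>) i) x"
      if "\<alpha> \<in> carrier ?G" "x \<in> C" "i \<in> {1..n}" for \<alpha> x i
    proof -
      have "inv_into UNIV (\<sigma> \<alpha>) i \<in> {1..n}"
        using permutes_in_image[OF permutes_inv[OF perm[OF that(1)]]] that(3) by simp
      then have "F x (inv_into UNIV (\<sigma> \<alpha>) i) \<in> C"
        using Fj that(2) by (fastforce simp: continuous_map_def Pi_iff)
      moreover have "\<phi> i \<alpha> \<in> carrier ?G"
        using \<phi>G that by (auto simp: Pi_iff)
      ultimately show ?thesis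
        using Feqv[OF that] deck(2) by (simp add: a_def lift_coordinate_def)
    qed
    \<comment> \<open>\<open>I0\<close> is nonempty because \<open>k\<close> is at least 1.\<close>
    obtain i where i: "i \<in> I0" using cI0 k by fastforce
    define J where "J = sigma_rel ?G n \<sigma> `` {i}"
    have Jmem: "j \<in> J \<longleftrightarrow> (\<exists>\<gamma>\<in>carrier ?G. \<sigma> \<gamma> j = i)" for j
    proof -
      have "j \<in> {1..n}" if "\<gamma> \<in> carrier ?G" "\<sigma> \<gamma> j = i" for \<gamma>
        using permutes_in_image[OF perm[OF that(1)], of j] that(2) i I0n by auto
      then show ?thesis using i I0n by (auto simp: J_def sigma_rel_def)
    qed
    have "J \<subseteq> I0"
    proof
      fix j assume "j \<in> J"
      then obtain \<gamma> where \<gamma>: "\<gamma> \<in> carrier ?G" "\<sigma> \<gamma> j = i" using Jmem by blast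
      \<comment> \<open>The points \<open>act \<gamma> xt\<close> and \<open>xt\<close> lie over the
        same base point. As \<open>i\<close> is selected at the first, its value
        \<open>a j xt\<close> lies in \<open>g (p xt)\<close>, so \<open>j\<close> is selected at
        the second.\<close>
      have "a i (act \<gamma> xt) = a j xt"
        using equiv[OF \<gamma>(1) xt, of i] \<gamma> i I0n permutes_inverses(2)[OF perm[OF \<gamma>(1)], of j] by auto
      moreover have "a i (act \<gamma> xt) \<in> g (p xt)"
        using I0[of "act \<gamma> xt"] deck[OF \<gamma>(1) xt] i by (auto simp: I_def)
      moreover have "j \<in> {1..n}"
        using permutes_in_image[OF perm[OF \<gamma>(1)], of j] \<gamma>(2) i I0n by auto
      ultimately show "j \<in> I0" using I0[OF xt] by (auto simp: I_def)
    qed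
    then have Jn: "J \<subseteq> {1..n}" and finJ: "finite J" using I0n finI0 finite_subset by auto
    \<comment> \<open>The class of the constant loop gives an element of the carrier; the inverse of
      its permutation sends \<open>i\<close> into \<open>J\<close>.\<close>
    have "loop_class X (\<lambda>_. p xt) \<in> carrier ?G"
      using xt imp by (auto simp: fundamental_group_def loops_at_def path_def pathstart_def
          pathfinish_def path_image_def)
    then have "J \<noteq> {}" using Jmem permutes_inverses(1)[OF perm] by (metis empty_iff)
    \<comment> \<open>If \<open>\<sigma> \<gamma>\<close> sends \<open>j\<close> to
      \<open>i\<close>, then \<open>\<sigma>\<close> of the product of \<open>\<gamma>\<close> and
      \<open>\<alpha>\<close> sends the preimage of \<open>j\<close> under
      \<open>\<sigma> \<alpha>\<close> to \<open>i\<close>. This gives one inclusion; an injective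
      self-map of the finite set \<open>J\<close> is onto.\<close>
    have invJ: "inv_into UNIV (\<sigma> \<alpha>) ` J = J" if \<alpha>: "\<alpha> \<in> carrier ?G" for \<alpha>
    proof (rule endo_inj_surj[OF finJ])
      show "inv_into UNIV (\<sigma> \<alpha>) ` J \<subseteq> J"
      proof clarify
        fix j assume "j \<in> J"
        then obtain \<gamma> where \<gamma>: "\<gamma> \<in> carrier ?G" "\<sigma> \<gamma> j = i" using Jmem by blast
        have "\<sigma> (\<gamma> \<otimes>\<^bsub>?G\<^esub> \<alpha>) (inv_into UNIV (\<sigma> \<alpha>) j) = i"
          using hom[OF \<gamma>(1) \<alpha>] \<gamma>(2) permutes_inverses(1)[OF perm[OF \<alpha>]] by simp
        then show "inv_into UNIV (\<sigma> \<alpha>) j \<in> J"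
          using Jmem fundamental_group_mult_closed[OF \<gamma>(1) \<alpha>] by blast
      qed
      show "inj_on (inv_into UNIV (\<sigma> \<alpha>)) J"
        by (rule inj_on_subset[OF permutes_inj[OF permutes_inv[OF perm[OF \<alpha>]]]]) simp
    qed
    have contJ: "continuous_map (top_of_set C) (unordered_config_space (card J) (top_of_set X))
        (\<lambda>x. (\<lambda>j. a j x) ` J)"
    proof (rule continuous_map_unordered_config[OF finJ])
      show "continuous_map (top_of_set C) (top_of_set X) (a j)" if "j \<in> J" for j
        by (rule acont[OF subsetD[OF Jn that]])
      show "inj_on (\<lambda>j. a j x) J" if "x \<in> topspace (top_of_set C)" for x
        using that by (intro inj_on_subset[OF Finj Jn]) simp
    qed
    have fibreJ: "(\<lambda>j. a j x') ` J = (\<lambda>j. a j x) ` J" if x: "x \<in> C" "x' \<in> C" "p x' = p x" for x x'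
    proof -
      obtain \<alpha> where \<alpha>: "\<alpha> \<in> carrier ?G" "x' = act \<alpha> x"
        using covering_action_transitive[OF assms(3,4) xt x] by blast
      \<comment> \<open>Passing to another point of the fibre only permutes the indices within
        \<open>J\<close>, so the set of values is unchanged and descends to
        \<open>X\<close>.\<close>
      have "(\<lambda>j. a j x') ` J = (\<lambda>j. a j x) ` inv_into UNIV (\<sigma> \<alpha>) ` J"
        unfolding \<alpha>(2) image_image using equiv[OF \<alpha>(1) x(1)] Jn by (intro image_cong) auto
      then show ?thesis using invJ[OF \<alpha>(1)] by simp
    qed
    have "\<exists>h. multivalued_map (card J) X h \<and> (\<forall>x\<in>C. h (p x) = (\<lambda>j. a j x) ` J)"
      by (rule multivalued_map_descend[OF cov contJ]) (rule fibreJ)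
    then obtain h where h: "multivalued_map (card J) X h"
      "\<forall>x\<in>C. h (p x) = (\<lambda>j. a j x) ` J"
      by (elim exE conjE)
    have "h y \<subseteq> g y" if y: "y \<in> X" for y
    proof -
      obtain x where x: "x \<in> C" "y = p x" using y imp by blast
      have "h y = (\<lambda>j. a j x) ` J" using h(2) x by simp
      also have "\<dots> \<subseteq> (\<lambda>j. a j x) ` I x" using \<open>J \<subseteq> I0\<close> I0[OF x(1)] by blast
      also have "\<dots> = g y" using aI[OF x(1)] x(2) by simp
      finally show ?thesis .
    qed
    moreover have "1 \<le> card J" using \<open>J \<noteq> {}\<close> finJ by (simp add: Suc_le_eq card_gt_0_iff)
    moreover have "card J \<le> k" using card_mono[OF finI0 \<open>J \<subseteq> I0\<close>] cI0 by simp
    ultimately have "submap X k g (card J) h" using h(1) by (simp add: submap_def)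
    \<comment> \<open>A smaller \<open>J\<close> would make \<open>h\<close> a proper submap of
      \<open>g\<close>.\<close>
    then have "card J = k"
      using irr \<open>card J \<le> k\<close> unfolding irreducible_map_def by (meson le_neq_implies_less)
    then have "J = I0" using card_subset_eq[OF finI0 \<open>J \<subseteq> I0\<close>] cI0 by simp
    moreover have "J \<in> {1..n} // sigma_rel ?G n \<sigma>"
      unfolding J_def using i I0n by (blast intro: quotientI)
    moreover have "(\<lambda>j. lift_coordinate F (\<iota> j)) ` {1..k} = lift_coordinate F ` I0"
      using \<iota>I0 by (metis image_image)
    ultimately show ?thesis unfolding sigma_classes_def by blast
  qed
  ultimately show ?thesis using \<iota>n by blast
qed

end
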